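(* Let ${}_RM$ be a Laskerian le-module over a commutative ring $R$ with $1$, and let $n$ be a proper submodule element of $M$. If $\{P_{i_1},P_{i_2},\dots,P_{i_k}\}$ ($k \ge 1$) is a set of isolated prime divisors of $n$ and, for a reduced primary decomposition $n = q_1\wedge\cdots\wedge q_m$, $q_{i_j}$ denotes the primary component with $\mathrm{Rad}(q_{i_j}) = P_{i_j}$, then $q_{i_1}\wedge q_{i_2}\wedge\cdots\wedge q_{i_k}$ depends only on the set $\{P_{i_1},\dots,P_{i_k}\}$ and not on the particular reduced primary decomposition of $n$. That is, for any two reduced primary decompositions of $n$, the meets of those components whose radicals belong to $\{P_{i_1},\dots,P_{i_k}\}$ coincide.
   Context: $R$ is a commutative ring with $1$. An le-semigroup $(M,+,\leqslant,e)$ is a commutative monoid with zero element $0_M$ that is at the same time a complete lattice with greatest element $e$, such that $m+\bigvee_{i\in I} m_i=\bigvee_{i\in I}(m+m_i)$ for all $m\in M$ and all families $(m_i)_{i\in I}$ in $M$. An le-module ${}_RM$ is an le-semigroup $M$ with a map $R\times M\to M$, $(r,m)\mapsto rm$, such that for all $r,r_1,r_2\in R$, $m,m_1,m_2\in M$ and families $(m_i)_{i\in I}$ in $M$: $r(m_1+m_2)=rm_1+rm_2$; $(r_1+r_2)m\leqslant r_1m+r_2m$; $(r_1r_2)m=r_1(r_2m)$; $1_Rm=m$; $0_Rm=r0_M=0_M$; $r(\bigvee_{i\in I} m_i)=\bigvee_{i\in I} rm_i$. A submodule element of $M$ is an $n\in M$ with $n+n\leqslant n$ and $rn\leqslant n$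 for all $r\in R$; it is proper if $n\ne e$. For a submodule element $l$, $\mathrm{Rad}(l)=\{a\in R: a^m e\leqslant l \text{ for some integer } m\geq 1\}$, an ideal of $R$. A proper submodule element $q$ is primary if for all $a\in R$, $x\in M$, $ax\leqslant q$ implies $x\leqslant q$ or $a^me\leqslant q$ for some integer $m\ge1$; then $\mathrm{Rad}(q)$ is a prime ideal. A primary decomposition of a submodule element $n$ is an expression $n=q_1\wedge\cdots\wedge q_k$ ($k\ge 1$) with all $q_i$ primary. It is reduced if (i) $\bigwedge_{j\neq i}q_j\not\leqslant q_i$ for each $i$ (the empty meet being $e$), and (ii) $\mathrm{Rad}(q_i)\neq \mathrm{Rad}(q_j)$ for $i\ne j$. The le-module ${}_RM$ is Laskerian if every proper submodule element of $M$ has a primary decomposition. The prime divisors (associated primes) of $n$ are the ideals $P_i=\mathrm{Rad}(q_i)$ for a reduced primary decomposition $n=q_1\wedge\cdots\wedge q_m$ (this set does not depend on the chosen reduced decomposition). A prime divisor $P_i$ of $n$ is isolated if it is minimal under inclusion in the set of all prime divisors of $n$. *)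

theory Defs
  imports Main
begin

text \<open>The greatest element \<open>e\<close> is \<^const>\<open>top\<close>. Distributivity of \<open>+\<close> over joins is required for
  nonempty families only: for the empty family it would read \<open>m + bot = bot\<close>, which, together
  with the corresponding law \<open>r bot = bot\<close> for scalars (so that \<open>bot = 0 bot = 0\<close>), would force
  every le-module to be trivial.\<close>

class le_semigroup = comm_monoid_add + complete_lattice +
  assumes add_Sup_distrib: "A \<noteq> {} \<Longrightarrow> m + Sup A = (SUP x\<in>A. m + x)"

text \<open>The sort \<open>{comm_ring, comm_monoid_mult}\<close> describes commutative rings with \<open>1\<close>; unlike
  \<open>comm_ring_1\<close> it does not exclude the zero ring.\<close>

locale le_module =
  fixes scale :: "'r::{comm_ring,comm_monoid_mult} \<Rightarrow> 'm::le_semigroup \<Rightarrow> 'm"  (infixr "*s" 75)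
  assumes scale_add_right: "r *s (x + y) = r *s x + r *s y"
    and scale_add_left_le: "(r + s) *s x \<le> r *s x + s *s x"
    and scale_scale: "(r * s) *s x = r *s (s *s x)"
    and scale_one: "1 *s x = x"
    and scale_zero_left: "0 *s x = 0"
    and scale_zero_right: "r *s 0 = 0"
    and scale_Sup_distrib: "A \<noteq> {} \<Longrightarrow> r *s Sup A = (SUP x\<in>A. r *s x)"
begin

definition submodule_element :: "'m \<Rightarrow> bool" where
  "submodule_element n \<longleftrightarrow> n + n \<le> n \<and> (\<forall>r. r *s n \<le> n)"

definition proper_submodule_element :: "'m \<Rightarrow> bool" where
  "proper_submodule_element n \<longleftrightarrow> submodule_element n \<and> n \<noteq> top"

definition Rad :: "'m \<Rightarrow> 'r set" where
  "Rad l = {a. \<exists>m\<ge>1. a ^ m *s top \<le> l}"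

definition primary :: "'m \<Rightarrow> bool" where
  "primary q \<longleftrightarrow> proper_submodule_element q \<and>
     (\<forall>a x. a *s x \<le> q \<longrightarrow> x \<le> q \<or> (\<exists>m\<ge>1. a ^ m *s top \<le> q))"

text \<open>A decomposition \<open>n = q\<^sub>1 \<and> \<dots> \<and> q\<^sub>k\<close> is given by \<open>k\<close> and a function \<open>q\<close>, of which only the
  values on \<open>{1..k}\<close> matter.\<close>

definition primary_decomposition :: "'m \<Rightarrow> nat \<Rightarrow> (nat \<Rightarrow> 'm) \<Rightarrow> bool" where
  "primary_decomposition n k q \<longleftrightarrow>
     k \<ge> 1 \<and> (\<forall>i\<in>{1..k}. primary (q i)) \<and> n = (INF i\<in>{1..k}. q i)"

definition reduced_primary_decomposition :: "'m \<Rightarrow> nat \<Rightarrow> (nat \<Rightarrow> 'm) \<Rightarrow> bool" where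
  "reduced_primary_decomposition n k q \<longleftrightarrow>
     primary_decomposition n k q \<and>
     (\<forall>i\<in>{1..k}. \<not> (INF j\<in>{1..k} - {i}. q j) \<le> q i) \<and>
     (\<forall>i\<in>{1..k}. \<forall>j\<in>{1..k}. i \<noteq> j \<longrightarrow> Rad (q i) \<noteq> Rad (q j))"

definition laskerian :: bool where
  "laskerian \<longleftrightarrow>
     (\<forall>n. proper_submodule_element n \<longrightarrow> (\<exists>k q. primary_decomposition n k q))"

text \<open>The radicals of the components of a reduced primary decomposition of \<open>n\<close> do not depend on
  the decomposition, so collecting them over all reduced primary decompositions yields the same
  set as any single one.\<close>

definition prime_divisors :: "'m \<Rightarrow> 'r set set" where
  "prime_divisors n =
     {P. \<exists>k q. reduced_primary_decomposition n k q \<and> (\<exists>i\<in>{1..k}. P = Rad (q i))}"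

definition isolated_prime_divisor :: "'m \<Rightarrow> 'r set \<Rightarrow> bool" where
  "isolated_prime_divisor n P \<longleftrightarrow>
     P \<in> prime_divisors n \<and> (\<forall>Q\<in>prime_divisors n. \<not> Q \<subset> P)"

end

end

theory Submission
  imports Defs
begin

text \<open>The primes not contained in a prime \<open>P\<close> are avoided simultaneously by one scalar outside
  \<open>P\<close>, a product of powers. If \<open>P\<close> is isolated, all components \<open>q\<^sub>j\<close> of a reduced decomposition
  other than the one, \<open>q\<^sub>i\<close>, belonging to \<open>P\<close> contain \<open>b e\<close> for a single \<open>b \<notin> P\<close>. Hence
  \<open>b q\<^sub>i \<le> n\<close>, so \<open>q\<^sub>i\<close> lies below every \<open>P\<close>-primary element above \<open>n\<close>, in particular below the
  \<open>P\<close>-component of any other decomposition. Isolated components are thus unique one by one.\<close>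

context le_module
begin

lemma scale_mono:
  assumes "x \<le> y"
  shows "r *s x \<le> r *s y"
proof -
  have "r *s y = r *s Sup {x, y}"
    using assms by (simp add: sup_absorb2)
  also have "\<dots> = sup (r *s x) (r *s y)"
    by (subst scale_Sup_distrib) simp_all
  finally show ?thesis
    by (simp add: le_iff_sup)
qed

lemma scale_submodule_element_le: "submodule_element n \<Longrightarrow> r *s n \<le> n"
  by (simp add: submodule_element_def)

lemma primary_submodule_element: "primary q \<Longrightarrow> submodule_element q"
  by (simp add: primary_def proper_submodule_element_def)

lemma primary_cancel:
  assumes "primary q" "a *s x \<le> q" "a \<notin> Rad q"
  shows "x \<le> q"
  using assms unfolding primary_def Rad_def by blast

lemma RadI: "a *s top \<le> l \<Longrightarrow> a \<in> Rad l"
  unfolding Rad_def by (auto intro!: exI[of _ 1])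

lemma power_in_RadD:
  assumes "a ^ m \<in> Rad l"
  shows "a \<in> Rad l"
proof -
  from assms obtain j where "j \<ge> 1" and j: "(a ^ m) ^ j *s top \<le> l"
    unfolding Rad_def by blast
  show ?thesis
  \<comment> \<open>The exponent 0 is allowed: then \<open>a ^ m = 1\<close>, which forces
    \<open>l = top\<close>, and every scalar lies in \<open>Rad l\<close>. So later uses need not
    track positivity of exponents.\<close>
  proof (cases "m = 0")
    case True
    then have "top \<le> l"
      using j by (simp add: scale_one)
    then show ?thesis
      by (intro RadI) (metis order_trans top_greatest)
  next
    case False
    then have "m * j \<ge> 1"
      using \<open>j \<ge> 1\<close> by (simp add: Suc_le_eq)
    moreover have "a ^ (m * j) *s top \<le> l"
      using j by (simp add: power_mult)
    ultimately show ?thesis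
      unfolding Rad_def by blast
  qed
qed

lemma one_notin_Rad_primary:
  assumes "primary q"
  shows "1 \<notin> Rad q"
  using assms
  by (auto simp: Rad_def scale_one top_unique primary_def proper_submodule_element_def)

text \<open>Commutativity splits \<open>(a * b) ^ m\<close>, and primary cancellation acts on
  \<open>b ^ m *s top\<close>. With \<open>one_notin_Rad_primary\<close> this makes the complement
  of \<open>Rad q\<close> multiplicatively closed, the form in which primeness is used
  below.\<close>

lemma mult_in_Rad_primaryD:
  assumes "primary q" "a * b \<in> Rad q"
  shows "a \<in> Rad q \<or> b \<in> Rad q"
proof -
  from assms(2) obtain m where "m \<ge> 1" and "(a * b) ^ m *s top \<le> q"
    unfolding Rad_def by blast
  then have "a ^ m *s (b ^ m *s top) \<le> q"
    by (simp add: power_mult_distrib scale_scale)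
  then have "a ^ m \<in> Rad q \<or> b ^ m *s top \<le> q"
    using primary_cancel[OF assms(1)] by blast
  then show ?thesis
    using \<open>m \<ge> 1\<close> power_in_RadD RadI by blast
qed

lemma ex_scalar_avoiding_Rad:
  assumes "primary p" "finite A"
    and "\<And>j. j \<in> A \<Longrightarrow> submodule_element (q j)"
    and "\<And>j. j \<in> A \<Longrightarrow> \<not> Rad (q j) \<subseteq> Rad p"
  shows "\<exists>b. b \<notin> Rad p \<and> (\<forall>j\<in>A. b *s top \<le> q j)"
  using assms(2-)
proof (induction A rule: finite_induct)
  case empty
  show ?case
    using one_notin_Rad_primary[OF assms(1)] by auto
next
  case (insert i A)
  then obtain b where b: "b \<notin> Rad p" "\<And>j. j \<in> A \<Longrightarrow> b *s top \<le> q j"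
    by auto
  from insert.prems(2)[of i] obtain a where a: "a \<in> Rad (q i)" "a \<notin> Rad p"
    by auto
  then obtain m where m: "a ^ m *s top \<le> q i"
    unfolding Rad_def by blast
  \<comment> \<open>The factor \<open>a ^ m\<close> pushes \<open>top\<close> below
    \<open>q i\<close>, the factor \<open>b\<close> below the earlier \<open>q j\<close>; submodule
    elements absorb the extra scalar.\<close>
  have "a ^ m * b \<notin> Rad p"
    using a(2) b(1) mult_in_Rad_primaryD[OF assms(1)] power_in_RadD by blast
  moreover have "(a ^ m * b) *s top \<le> q j" if "j \<in> insert i A" for j
  proof (cases "j = i")
    case True
    have "(a ^ m * b) *s top \<le> a ^ m *s top"
      by (simp add: scale_scale scale_mono)
    then show ?thesis
      using m True by simp
  next
    case False
    then have "(a ^ m * b) *s top \<le> a ^ m *s q j"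
      using b(2) that by (simp add: scale_scale scale_mono)
    also have "\<dots> \<le> q j"
      using insert.prems(1) that by (intro scale_submodule_element_le)
    finally show ?thesis .
  qed
  ultimately show ?case
    by blast
qed

text \<open>Otherwise an avoiding scalar \<open>b\<close> would send \<open>top\<close> below every
  \<open>q j\<close>, hence below \<open>p\<close>, and so lie in \<open>Rad p\<close> after all.
  This is the analogue of a prime ideal containing a finite intersection of ideals.\<close>

lemma Inf_primary_le_imp_Rad_subset:
  assumes "primary p" "finite A" "\<And>j. j \<in> A \<Longrightarrow> submodule_element (q j)"
    and "(INF j\<in>A. q j) \<le> p"
  shows "\<exists>j\<in>A. Rad (q j) \<subseteq> Rad p"
proof (rule ccontr)
  assume "\<not> ?thesis"
  then obtain b where "b \<notin> Rad p" "\<forall>j\<in>A. b *s top \<le> q j"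
    using ex_scalar_avoiding_Rad[of p A q] assms by blast
  then show False
    using assms(4) RadI by (metis INF_greatest order_trans)
qed

lemma component_le_primary:
  assumes "primary p" "finite A" "\<And>j. j \<in> A \<Longrightarrow> submodule_element (q j)"
    and "(INF j\<in>A. q j) \<le> p" "i \<in> A"
    and "\<And>j. j \<in> A \<Longrightarrow> j \<noteq> i \<Longrightarrow> \<not> Rad (q j) \<subseteq> Rad p"
  shows "q i \<le> p"
proof -
  obtain b where b: "b \<notin> Rad p" "\<And>j. j \<in> A - {i} \<Longrightarrow> b *s top \<le> q j"
    using ex_scalar_avoiding_Rad[of p "A - {i}" q] assms by auto
  \<comment> \<open>The component \<open>q i\<close> itself is closed under scalars; for the others
    \<open>q i \<le> top\<close> suffices.\<close>
  have "b *s q i \<le> q j" if "j \<in> A" for j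
  proof (cases "j = i")
    case True
    then show ?thesis
      using assms(3) that by (simp add: scale_submodule_element_le)
  next
    case False
    then show ?thesis
      using b(2)[of j] that scale_mono[of "q i" top b] by auto
  qed
  then have "b *s q i \<le> p"
    using assms(4) by (meson INF_greatest order_trans)
  then show ?thesis
    using assms(1) b(1) primary_cancel by blast
qed

lemma reduced_primary_decompositionD:
  assumes "reduced_primary_decomposition n k q"
  shows "\<And>i. i \<in> {1..k} \<Longrightarrow> primary (q i)"
    and "(INF i\<in>{1..k}. q i) = n"
    and "\<And>i j. i \<in> {1..k} \<Longrightarrow> j \<in> {1..k} \<Longrightarrow> Rad (q i) = Rad (q j) \<Longrightarrow> i = j"
    and "\<And>i. i \<in> {1..k} \<Longrightarrow> Rad (q i) \<in> prime_divisors n"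
  using assms
  unfolding reduced_primary_decomposition_def primary_decomposition_def prime_divisors_def
  by blast+

lemma isolated_component_le:
  assumes "reduced_primary_decomposition n k q"
    and "primary p" "n \<le> p" "isolated_prime_divisor n (Rad p)"
  shows "\<exists>i\<in>{1..k}. Rad (q i) = Rad p \<and> q i \<le> p"
proof -
  note q = reduced_primary_decompositionD[OF assms(1)]
  have sub: "submodule_element (q j)" if "j \<in> {1..k}" for j
    using q(1)[OF that] by (rule primary_submodule_element)
  have le: "(INF i\<in>{1..k}. q i) \<le> p"
    using q(2) assms(3) by simp
  \<comment> \<open>Isolation enters here: \<open>Rad (q j)\<close> is a prime divisor of
    \<open>n\<close>, so it cannot lie strictly inside \<open>Rad p\<close>.\<close>
  have minimal: "Rad (q j) = Rad p" if "j \<in> {1..k}" "Rad (q j) \<subseteq> Rad p" for j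
    using assms(4) q(4) that unfolding isolated_prime_divisor_def by blast
  obtain i where i: "i \<in> {1..k}" "Rad (q i) = Rad p"
    using Inf_primary_le_imp_Rad_subset[OF assms(2) finite_atLeastAtMost sub le] minimal
    by blast
  have "q i \<le> p"
  proof (rule component_le_primary[OF assms(2) finite_atLeastAtMost sub le i(1)])
    \<comment> \<open>By minimality such a \<open>j\<close> would share its radical with
      \<open>i\<close>, but the radicals in a reduced decomposition are distinct.\<close>
    show "\<not> Rad (q j) \<subseteq> Rad p" if "j \<in> {1..k}" "j \<noteq> i" for j
      using q(3)[of j i] minimal[of j] i that by auto
  qed
  with i show ?thesis
    by blast
qed

lemma isolated_components_Inf_le:
  assumes "\<And>P. P \<in> Ps \<Longrightarrow> isolated_prime_divisor n P"
    and "reduced_primary_decomposition n k q"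
    and "reduced_primary_decomposition n k' q'"
  shows "(INF i\<in>{i\<in>{1..k}. Rad (q i) \<in> Ps}. q i) \<le> (INF i\<in>{i\<in>{1..k'}. Rad (q' i) \<in> Ps}. q' i)"
proof (rule INF_mono)
  fix j assume "j \<in> {i\<in>{1..k'}. Rad (q' i) \<in> Ps}"
  then have j: "j \<in> {1..k'}" "Rad (q' j) \<in> Ps"
    by auto
  note q' = reduced_primary_decompositionD[OF assms(3)]
  have "n \<le> q' j"
    using q'(2) j(1) by (metis INF_lower)
  \<comment> \<open>The component found below \<open>q' j\<close> has the same radical, so it is
    selected by \<open>Ps\<close> too.\<close>
  then show "\<exists>i\<in>{i\<in>{1..k}. Rad (q i) \<in> Ps}. q i \<le> q' j"
    using isolated_component_le[OF assms(2) q'(1)[OF j(1)] _ assms(1)[OF j(2)]] j(2) by auto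
qed

end

theorem theorem4p11:
  fixes scale :: "'r::{comm_ring,comm_monoid_mult} \<Rightarrow> 'm::le_semigroup \<Rightarrow> 'm"
    and n :: 'm and Ps :: "'r set set"
    and k k' :: nat and q q' :: "nat \<Rightarrow> 'm"
  assumes "le_module scale"
    and "le_module.laskerian scale"
    and "le_module.proper_submodule_element scale n"
    and "finite Ps" and "Ps \<noteq> {}"
    and "\<And>P. P \<in> Ps \<Longrightarrow> le_module.isolated_prime_divisor scale n P"
    and "le_module.reduced_primary_decomposition scale n k q"
    and "le_module.reduced_primary_decomposition scale n k' q'"
  shows "(INF i\<in>{i\<in>{1..k}. le_module.Rad scale (q i) \<in> Ps}. q i) =
         (INF i\<in>{i\<in>{1..k'}. le_module.Rad scale (q' i) \<in> Ps}. q' i)"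
proof -
  interpret le_module scale
    by fact
  \<comment> \<open>The two decompositions play symmetric roles, so both inequalities are instances
    of one lemma.\<close>
  show ?thesis
    using assms(6-8) by (intro antisym isolated_components_Inf_le) auto
qed

end
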